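(* Let $\mathcal O$ be the ring of integers of a number field, and let $G=PSL(2,\mathcal O)$ or $G=PE=E/\langle\pm I\rangle$, where $E\subseteq SL(2,\mathcal O)$ is the elementary matrix group. Let $K$ be a subgroup of $G$ of finite index, and suppose that the level of $K$ is $m$. Then $K$ is a congruence subgroup of $G$ if and only if $G(m)\subseteq K$.
   Context: Let $\{w_1=1,w_2,\dots,w_n\}$ be an integral basis of $\mathcal O$. The elementary matrix group $E$ is the subgroup of $SL(2,\mathcal O)$ generated by $T_i=\begin{pmatrix}1&w_i\\0&1\end{pmatrix}$ ($1\le i\le n$) and $S=\begin{pmatrix}0&1\\-1&0\end{pmatrix}$. For a nonzero ideal $\pi$ of $\mathcal O$, $G(\pi)=\{x\in G: x\equiv\pm I \pmod \pi\}$; for a positive integer $m$, $G(m)$ means $G(m\mathcal O)$. A subgroup $K$ of $G$ is congruence if it contains $G(\pi)$ for some nonzero ideal $\pi\subseteq\mathcal O$. The level of a finite index subgroup $K$ of $G$ is the smallest positive integer $m$ such that the normal closure in $G$ of the subgroup generated by $\pm\begin{pmatrix}1&mw_i\\0&1\end{pmatrix}$, $1\le i\le n$, is contained in $K$. *)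

theory Defs
  imports
    "HOL-Analysis.Analysis"
    "HOL-Computational_Algebra.Polynomial"
    "HOL-Algebra.Ideal"
    "HOL-Algebra.Generated_Groups"
begin

definition number_field :: "'a::field_char_0 itself \<Rightarrow> bool" where
  "number_field _ \<longleftrightarrow>
     (\<exists>B. finite_dimensional_vector_space (\<lambda>(q::rat) (x::'a). of_rat q * x) B)"

definition ring_of_integers :: "'a::field_char_0 ring" where
  "ring_of_integers =
     \<lparr>carrier = {x. algebraic_int x}, mult = (*), one = 1, zero = 0, add = (+)\<rparr>"

definition integral_basis :: "nat \<Rightarrow> (nat \<Rightarrow> 'a::field_char_0) \<Rightarrow> bool" where
  "integral_basis n w \<longleftrightarrow>
     bij_betw (\<lambda>c. \<Sum>i=1..n. of_int (c i) * w i)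
       ({1..n} \<rightarrow>\<^sub>E (UNIV :: int set)) (carrier ring_of_integers)"

definition SL2 :: "('a::field_char_0 ^ 2 ^ 2) monoid" where
  "SL2 = \<lparr>carrier = {A. (\<forall>i j. A $ i $ j \<in> carrier ring_of_integers) \<and> det A = 1},
          mult = (**), one = mat 1\<rparr>"

definition elem_T :: "'a::field_char_0 \<Rightarrow> 'a ^ 2 ^ 2" where
  "elem_T x = vector [vector [1, x], vector [0, 1]]"

definition elem_S :: "'a::field_char_0 ^ 2 ^ 2" where
  "elem_S = vector [vector [0, 1], vector [-1, 0]]"

definition elementary_group :: "nat \<Rightarrow> (nat \<Rightarrow> 'a::field_char_0) \<Rightarrow> ('a ^ 2 ^ 2) monoid" where
  "elementary_group n w =
     SL2\<lparr>carrier := generate SL2 (insert elem_S ((\<lambda>i. elem_T (w i)) ` {1..n}))\<rparr>"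

text \<open>The coset of \<open>A\<close> modulo the central subgroup \<open>{I, -I}\<close>.\<close>

definition pm :: "'a::field_char_0 ^ 2 ^ 2 \<Rightarrow> ('a ^ 2 ^ 2) set" where
  "pm A = {A, - A}"

definition PSL2 :: "('a::field_char_0 ^ 2 ^ 2) set monoid" where
  "PSL2 = SL2 Mod pm (mat 1)"

definition PE :: "nat \<Rightarrow> (nat \<Rightarrow> 'a::field_char_0) \<Rightarrow> ('a ^ 2 ^ 2) set monoid" where
  "PE n w = elementary_group n w Mod pm (mat 1)"

definition mat_cong :: "'a::field_char_0 set \<Rightarrow> 'a ^ 2 ^ 2 \<Rightarrow> 'a ^ 2 ^ 2 \<Rightarrow> bool" where
  "mat_cong I A B \<longleftrightarrow> (\<forall>i j. A $ i $ j - B $ i $ j \<in> I)"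

text \<open>The condition on a class \<open>X = {A, -A}\<close> does not depend on the representative \<open>A\<close>.\<close>

definition principal_congruence ::
    "('a::field_char_0 ^ 2 ^ 2) set monoid \<Rightarrow> 'a set \<Rightarrow> ('a ^ 2 ^ 2) set set" where
  "principal_congruence G I =
     {X \<in> carrier G. \<exists>A\<in>X. mat_cong I A (mat 1) \<or> mat_cong I A (- mat 1)}"

definition congruence_subgroup ::
    "('a::field_char_0 ^ 2 ^ 2) set monoid \<Rightarrow> ('a ^ 2 ^ 2) set set \<Rightarrow> bool" where
  "congruence_subgroup G K \<longleftrightarrow>
     subgroup K G \<and>
     (\<exists>I. ideal I ring_of_integers \<and> I \<noteq> {0} \<and> principal_congruence G I \<subseteq> K)"

definition normal_closure :: "('g, 'b) monoid_scheme \<Rightarrow> 'g set \<Rightarrow> 'g set" where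
  "normal_closure G H = (\<lambda>N. N \<lhd> G) hull H"

text \<open>The set over which the least element is taken is nonempty whenever \<open>K\<close> has finite
  index in \<open>G\<close>; otherwise the value may be meaningless.\<close>

definition level ::
    "('a::field_char_0 ^ 2 ^ 2) set monoid \<Rightarrow> nat \<Rightarrow> (nat \<Rightarrow> 'a) \<Rightarrow> ('a ^ 2 ^ 2) set set \<Rightarrow> nat" where
  "level G n w K =
     (LEAST m. 0 < m \<and>
        normal_closure G (generate G ((\<lambda>i. pm (elem_T (of_nat m * w i))) ` {1..n})) \<subseteq> K)"

end

theory Submission
  imports
    Defs
    "Jordan_Normal_Form.Char_Poly"
begin

text \<open>
  The finite index of \<open>K\<close> makes the level well defined and positive: a suitable factorial power
  of every element lies in the normal core of \<open>K\<close>. So the core contains all elementary matrices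
  with off-diagonal entry in \<open>m\<O>\<close>. If \<open>K\<close> contains \<open>G(\<pi>)\<close>, pick a positive integer \<open>k\<close>
  in \<open>\<pi>\<close>. The ring \<open>\<O>/k\<close> is finite, hence has stable range one, and so every matrix
  congruent to \<open>I\<close> modulo \<open>m\<close> agrees modulo \<open>k\<close> with a product of \<open>E\<close>-conjugates of elementary
  matrices with entry in \<open>m\<O>\<close>. Therefore \<open>G(m) \<subseteq> G(k) \<cdot> core(K) \<subseteq> K\<close>.
\<close>

section \<open>Closure of the algebraic integers under addition and multiplication\<close>

text \<open>The additive group generated by a family. Indexing by an arbitrary set lets monomials in
  two elements be indexed by pairs of exponents.\<close>

definition int_span :: "('i \<Rightarrow> 'a::comm_ring_1) \<Rightarrow> 'i set \<Rightarrow> 'a set" where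
  "int_span v I = range (\<lambda>c. \<Sum>i\<in>I. of_int (c i) * v i)"

lemma int_spanI: "x = (\<Sum>i\<in>I. of_int (c i) * v i) \<Longrightarrow> x \<in> int_span v I"
  by (auto simp: int_span_def)

lemma int_span_zero: "0 \<in> int_span v I"
  by (rule int_spanI[where c = "\<lambda>_. 0"]) simp

lemma int_span_base:
  assumes "finite I" "i \<in> I"
  shows "v i \<in> int_span v I"
proof (rule int_spanI)
  have "(\<Sum>j\<in>I. of_int (if j = i then 1 else 0) * v j) = (\<Sum>j\<in>I. if j = i then v j else 0)"
    by (rule sum.cong) auto
  then show "v i = (\<Sum>j\<in>I. of_int (if j = i then 1 else 0) * v j)"
    using assms by simp
qed

lemma int_span_add:
  assumes "x \<in> int_span v I" "y \<in> int_span v I"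
  shows "x + y \<in> int_span v I"
proof -
  obtain c d where "x = (\<Sum>i\<in>I. of_int (c i) * v i)" "y = (\<Sum>i\<in>I. of_int (d i) * v i)"
    using assms by (auto simp: int_span_def)
  then show ?thesis
    by (intro int_spanI[where c = "\<lambda>i. c i + d i"]) (simp add: sum.distrib distrib_right)
qed

lemma int_span_of_int_mult:
  assumes "x \<in> int_span v I"
  shows "of_int n * x \<in> int_span v I"
proof -
  obtain c where "x = (\<Sum>i\<in>I. of_int (c i) * v i)"
    using assms by (auto simp: int_span_def)
  then show ?thesis
    by (intro int_spanI[where c = "\<lambda>i. n * c i"]) (simp add: sum_distrib_left mult.assoc)
qed

lemma int_span_sum: "(\<And>j. j \<in> J \<Longrightarrow> f j \<in> int_span v I) \<Longrightarrow> sum f J \<in> int_span v I"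
  by (induction J rule: infinite_finite_induct) (simp_all add: int_span_zero int_span_add)

lemma int_span_subset:
  assumes "\<And>i. i \<in> I \<Longrightarrow> v i \<in> int_span v' I'"
  shows "int_span v I \<subseteq> int_span v' I'"
  unfolding int_span_def[of v] using assms
  by (intro image_subsetI int_span_sum int_span_of_int_mult)

text \<open>Multiplication by \<open>x\<close> is additive, so stability only has to be checked on
  generators.\<close>

lemma int_span_mult_stable:
  assumes stable: "\<And>i. i \<in> I \<Longrightarrow> x * v i \<in> int_span v I" and y: "y \<in> int_span v I"
  shows "x * y \<in> int_span v I"
proof -
  obtain c where c: "y = (\<Sum>i\<in>I. of_int (c i) * v i)"
    using y by (auto simp: int_span_def)
  have "x * y = (\<Sum>i\<in>I. of_int (c i) * (x * v i))"
    by (simp add: c sum_distrib_left mult_ac)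
  then show ?thesis
    by (simp add: int_span_sum int_span_of_int_mult stable)
qed

text \<open>The vector of the \<open>v i\<close> is an eigenvector, for \<open>z\<close>, of the
  integer matrix \<open>c\<close>. Hence \<open>z\<close> is a root of its characteristic
  polynomial, which is monic with integer coefficients.\<close>

lemma algebraic_int_if_stable_nat:
  fixes z :: "'a::field_char_0" and N :: nat
  assumes stable: "\<And>i. i < N \<Longrightarrow> z * v i = (\<Sum>j<N. of_int (c i j) * v j)"
    and nz: "k < N" "v k \<noteq> 0"
  shows "algebraic_int z"
proof -
  define A where "A = Matrix.mat N N (\<lambda>(i, j). c i j)"
  have A: "A \<in> carrier_mat N N"
    by (simp add: A_def)
  let ?A = "map_mat (of_int :: int \<Rightarrow> 'a) A"
  let ?v = "Matrix.vec N v"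
  have A': "?A \<in> carrier_mat N N"
    using A by simp
  have "eigenvector ?A ?v z"
    unfolding eigenvector_def
  proof (intro conjI)
    show "?v \<in> carrier_vec (dim_row ?A)"
      using A by simp
    show "?v \<noteq> 0\<^sub>v (dim_row ?A)"
    proof
      assume "?v = 0\<^sub>v (dim_row ?A)"
      then have "vec_index ?v k = vec_index (0\<^sub>v (dim_row ?A)) k"
        by simp
      then show False
        using nz A by simp
    qed
    show "?A *\<^sub>v ?v = z \<cdot>\<^sub>v ?v"
      by (rule eq_vecI) (use A in \<open>auto simp: A_def scalar_prod_def stable lessThan_atLeast0\<close>)
  qed
  then have "poly (char_poly ?A) z = 0"
    using eigenvalue_root_char_poly[OF A'] by (auto simp: eigenvalue_def)
  then have "poly (map_poly of_int (char_poly A)) z = 0"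
    by (simp add: of_int_hom.char_poly_hom[OF A])
  moreover have "lead_coeff (char_poly A) = 1"
    using degree_monic_char_poly[OF A] by auto
  ultimately show ?thesis
    by (auto simp: algebraic_int_altdef_ipoly)
qed

text \<open>Enumerating \<open>I\<close> transfers the eigenvalue argument from an initial segment
  of the naturals to any finite index set.\<close>

lemma algebraic_int_if_stable:
  fixes z :: "'a::field_char_0"
  assumes fin: "finite I" and stable: "\<And>i. i \<in> I \<Longrightarrow> z * v i \<in> int_span v I"
    and nz: "k \<in> I" "v k \<noteq> 0"
  shows "algebraic_int z"
proof -
  have "\<exists>c. z * v i = (\<Sum>j\<in>I. of_int (c j) * v j)" if "i \<in> I" for i
    using stable[OF that] by (auto simp: int_span_def)
  then obtain c where c: "\<And>i. i \<in> I \<Longrightarrow> z * v i = (\<Sum>j\<in>I. of_int (c i j) * v j)"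
    by metis
  obtain h where h: "bij_betw h {..<card I} I"
    using ex_bij_betw_nat_finite[OF fin] by (auto simp: lessThan_atLeast0)
  obtain l where l: "l < card I" "h l = k"
    using h nz by (metis bij_betw_iff_bijections lessThan_iff)
  show ?thesis
  proof (rule algebraic_int_if_stable_nat)
    show "z * v (h i) = (\<Sum>j<card I. of_int (c (h i) (h j)) * v (h j))" if "i < card I" for i
    proof -
      have "h i \<in> I"
        using h that by (auto simp: bij_betw_def)
      then show ?thesis
        using c sum.reindex_bij_betw[OF h, of "\<lambda>j. of_int (c (h i) j) * v j"] by simp
    qed
    show "l < card I" "v (h l) \<noteq> 0"
      using l nz by auto
  qed
qed

lemma algebraic_int_power_reduce:
  fixes x :: "'a::field_char_0"
  assumes "algebraic_int x"
  obtains p c where "p > 0" "x ^ p = (\<Sum>i<p. of_int (c i) * x ^ i)"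
proof -
  obtain q :: "int poly" where q: "poly (map_poly of_int q) x = 0" "lead_coeff q = 1"
    using assms by (auto simp: algebraic_int_altdef_ipoly)
  have "0 = (\<Sum>i\<le>degree q. of_int (coeff q i) * x ^ i)"
    using q by (simp add: poly_altdef)
  also have "\<dots> = x ^ degree q + (\<Sum>i<degree q. of_int (coeff q i) * x ^ i)"
    using q by (simp add: lessThan_Suc_atMost[symmetric])
  finally have eq: "x ^ degree q = (\<Sum>i<degree q. of_int (- coeff q i) * x ^ i)"
    by (simp add: sum_negf eq_neg_iff_add_eq_0)
  \<comment> \<open>In degree 0 the equation would read 1 = 0.\<close>
  moreover have "degree q > 0"
    using eq by (cases "degree q") auto
  ultimately show ?thesis
    by (intro that)
qed

text \<open>Multiplication by \<open>x\<close> raises the first exponent by one. It leaves the grid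
  only at the top exponent, where the relation for \<open>x ^ p\<close> brings it back.\<close>

lemma algebraic_int_monomials_stable:
  fixes x y :: "'a::field_char_0"
  assumes "x ^ p = (\<Sum>i<p. of_int (c i) * x ^ i)" "i < p" "j < q"
  shows "x * (x ^ i * y ^ j) \<in> int_span (\<lambda>(i, j). x ^ i * y ^ j) ({..<p} \<times> {..<q})"
    (is "_ \<in> int_span ?v ?I")
proof (cases "Suc i < p")
  case True
  then have "?v (Suc i, j) \<in> int_span ?v ?I"
    using assms by (intro int_span_base) auto
  then show ?thesis
    by (simp add: mult_ac)
next
  case False
  then have "p = Suc i"
    using assms by simp
  then have "x * (x ^ i * y ^ j) = x ^ p * y ^ j"
    by simp
  also have "\<dots> = (\<Sum>k<p. of_int (c k) * ?v (k, j))"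
    by (subst assms(1)) (simp add: sum_distrib_right mult.assoc)
  also have "\<dots> \<in> int_span ?v ?I"
    using assms by (intro int_span_sum int_span_of_int_mult int_span_base) auto
  finally show ?thesis .
qed

text \<open>The span of the monomials with exponents below \<open>p\<close> and \<open>q\<close> is
  stable under \<open>x\<close> and under \<open>y\<close>, hence under their sum and product, and
  it contains 1.\<close>

lemma algebraic_int_add_mult:
  fixes x y :: "'a::field_char_0"
  assumes "algebraic_int x" "algebraic_int y"
  shows algebraic_int_add: "algebraic_int (x + y)"
    and algebraic_int_mult: "algebraic_int (x * y)"
proof -
  obtain p c where p: "p > 0" "x ^ p = (\<Sum>i<p. of_int (c i) * x ^ i)"
    by (rule algebraic_int_power_reduce[OF assms(1)])
  obtain q d where q: "q > 0" "y ^ q = (\<Sum>i<q. of_int (d i) * y ^ i)"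
    by (rule algebraic_int_power_reduce[OF assms(2)])
  let ?v = "\<lambda>(i, j). x ^ i * y ^ j" and ?I = "{..<p} \<times> {..<q}"
  let ?v' = "\<lambda>(i, j). y ^ i * x ^ j" and ?I' = "{..<q} \<times> {..<p}"
  \<comment> \<open>Stability under \<open>y\<close> comes from the monomial lemma with the roles
    exchanged; this inclusion translates it back to the original order of the exponents.\<close>
  have swap: "int_span ?v' ?I' \<subseteq> int_span ?v ?I"
  proof (rule int_span_subset)
    fix ij assume "ij \<in> ?I'"
    then have "?v (prod.swap ij) \<in> int_span ?v ?I"
      by (intro int_span_base) auto
    then show "?v' ij \<in> int_span ?v ?I"
      by (simp add: case_prod_beta mult.commute)
  qed
  have x: "x * ?v ij \<in> int_span ?v ?I" if "ij \<in> ?I" for ij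
    using that algebraic_int_monomials_stable[OF p(2)] by auto
  have y: "y * ?v ij \<in> int_span ?v ?I" if "ij \<in> ?I" for ij
  proof -
    have "y * ?v' (prod.swap ij) \<in> int_span ?v' ?I'"
      using that algebraic_int_monomials_stable[OF q(2), of "snd ij" "fst ij" p x] by auto
    then show ?thesis
      using swap by (auto simp: case_prod_beta mult_ac)
  qed
  have "(x + y) * ?v ij \<in> int_span ?v ?I" if "ij \<in> ?I" for ij
    using int_span_add[OF x[OF that] y[OF that]] by (simp add: distrib_right)
  then show "algebraic_int (x + y)"
    by (rule algebraic_int_if_stable[where k = "(0, 0)", rotated]) (use p(1) q(1) in auto)
  have "(x * y) * ?v ij \<in> int_span ?v ?I" if "ij \<in> ?I" for ij
    using int_span_mult_stable[OF x y[OF that]] by (simp add: mult.assoc)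
  then show "algebraic_int (x * y)"
    by (rule algebraic_int_if_stable[where k = "(0, 0)", rotated]) (use p(1) q(1) in auto)
qed

section \<open>Ideals and finite quotients of the ring of integers\<close>

lemma algebraic_int_diff:
  fixes x y :: "'a::field_char_0"
  shows "algebraic_int x \<Longrightarrow> algebraic_int y \<Longrightarrow> algebraic_int (x - y)"
  using algebraic_int_add[of x "- y"] by auto

lemma algebraic_int_power:
  fixes x :: "'a::field_char_0"
  shows "algebraic_int x \<Longrightarrow> algebraic_int (x ^ n)"
  by (induction n) (auto intro: int_imp_algebraic_int algebraic_int_mult)

lemma algebraic_int_sum:
  fixes f :: "'b \<Rightarrow> 'a::field_char_0"
  assumes "\<And>i. i \<in> I \<Longrightarrow> algebraic_int (f i)"
  shows "algebraic_int (sum f I)"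
  using assms by (induction I rule: infinite_finite_induct) (simp_all add: algebraic_int_add)

lemma algebraic_int_1: "algebraic_int (1 :: 'a::field_char_0)"
  and algebraic_int_of_int: "algebraic_int (of_int k :: 'a)"
  and algebraic_int_of_nat: "algebraic_int (of_nat l :: 'a)"
  by (auto intro: int_imp_algebraic_int)

lemmas algebraic_int_closed = algebraic_int_1 algebraic_int_of_int algebraic_int_of_nat
  algebraic_int_add algebraic_int_diff algebraic_int_minus algebraic_int_mult
  algebraic_int_power algebraic_int_sum

lemma cring_ring_of_integers: "cring (ring_of_integers :: 'a::field_char_0 ring)"
proof (rule cringI)
  show "abelian_group (ring_of_integers :: 'a ring)"
  proof (rule abelian_groupI)
    fix x :: 'a assume "x \<in> carrier ring_of_integers"
    then show "\<exists>y\<in>carrier ring_of_integers. y \<oplus>\<^bsub>ring_of_integers\<^esub> x = \<zero>\<^bsub>ring_of_integers\<^esub>"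
      by (auto simp: ring_of_integers_def intro!: bexI[of _ "- x"])
  qed (auto simp: ring_of_integers_def algebra_simps intro: algebraic_int_closed)
  show "Group.comm_monoid (ring_of_integers :: 'a ring)"
    by (rule comm_monoidI) (auto simp: ring_of_integers_def algebra_simps intro: algebraic_int_closed)
qed (auto simp: ring_of_integers_def algebra_simps)

lemma PIdl_ring_of_integers:
  "PIdl\<^bsub>ring_of_integers\<^esub> x = {y * x | y. algebraic_int (y :: 'a::field_char_0)}"
  by (auto simp: cgenideal_def ring_of_integers_def)

lemma ideal_PIdl:
  "algebraic_int (x :: 'a::field_char_0) \<Longrightarrow> ideal (PIdl\<^bsub>ring_of_integers\<^esub> x) ring_of_integers"
  by (intro cring.cgenideal_ideal cring_ring_of_integers) (simp add: ring_of_integers_def)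

context
  fixes J :: "'a::field_char_0 set"
  assumes J: "ideal J ring_of_integers"
begin

interpretation ideal J ring_of_integers
  by (rule J)

lemma ideal_integers_subset: "x \<in> J \<Longrightarrow> algebraic_int x"
  using a_subset by (auto simp: ring_of_integers_def)

lemma ideal_integers_0: "0 \<in> J"
  using additive_subgroup.zero_closed[OF is_additive_subgroup] by (simp add: ring_of_integers_def)

lemma ideal_integers_add: "x \<in> J \<Longrightarrow> y \<in> J \<Longrightarrow> x + y \<in> J"
  using additive_subgroup.a_closed[OF is_additive_subgroup, of x y]
  by (simp add: ring_of_integers_def)

lemma ideal_integers_mult_left: "algebraic_int r \<Longrightarrow> x \<in> J \<Longrightarrow> r * x \<in> J"
  using I_l_closed[of x r] by (simp add: ring_of_integers_def)

lemma ideal_integers_mult_right: "algebraic_int r \<Longrightarrow> x \<in> J \<Longrightarrow> x * r \<in> J"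
  using ideal_integers_mult_left[of r x] by (simp add: mult.commute)

lemma ideal_integers_minus: "x \<in> J \<Longrightarrow> - x \<in> J"
  using ideal_integers_mult_left[of "- 1" x] by (auto intro: algebraic_int_closed)

lemma ideal_integers_diff: "x \<in> J \<Longrightarrow> y \<in> J \<Longrightarrow> x - y \<in> J"
  using ideal_integers_add[of x "- y"] ideal_integers_minus by simp

end

lemmas ideal_integers = ideal_integers_0 ideal_integers_add ideal_integers_mult_left
  ideal_integers_mult_right ideal_integers_minus ideal_integers_diff

text \<open>As long as the constant coefficient vanishes, the variable can be divided out, and the
  nonzero \<open>x\<close> remains a root.\<close>

lemma nonzero_const_annihilator:
  fixes x :: "'a::field_char_0" and p :: "int poly"
  assumes "p \<noteq> 0" "poly (map_poly of_int p) x = 0" "x \<noteq> 0"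
  shows "\<exists>a q. a \<noteq> 0 \<and> poly (map_poly of_int (pCons a q)) x = 0"
  using assms
proof (induction p)
  case (pCons a p)
  show ?case
  proof (cases "a = 0")
    case True
    with pCons have "p \<noteq> 0" "poly (map_poly of_int p) x = 0"
      by (auto simp: map_poly_pCons)
    with pCons show ?thesis
      by blast
  qed (use pCons in blast)
qed simp

text \<open>The nonzero constant coefficient of an integer polynomial that kills a nonzero
  \<open>x\<close> in \<open>I\<close> is a multiple of \<open>x\<close> in the ring of integers, so
  it lies in \<open>I\<close>; its absolute value is the required integer.\<close>

lemma ideal_integers_contains_nat:
  fixes I :: "'a::field_char_0 set"
  assumes I: "ideal I ring_of_integers" "I \<noteq> {0}"
  obtains k where "k > 0" "of_nat k \<in> I"
proof -
  obtain x where x: "x \<in> I" "x \<noteq> 0"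
    using I ideal_integers_0 by blast
  have alg: "algebraic_int x"
    using ideal_integers_subset[OF I(1) x(1)] .
  then obtain p :: "int poly" where "poly (map_poly of_int p) x = 0" "lead_coeff p = 1"
    by (auto simp: algebraic_int_altdef_ipoly)
  then obtain a q where a: "a \<noteq> 0" "poly (map_poly of_int (pCons a q)) x = 0"
    using nonzero_const_annihilator[of p x] x by fastforce
  then have "of_int a = - poly (map_poly of_int q) x * x"
    by (simp add: map_poly_pCons eq_neg_iff_add_eq_0 mult.commute)
  moreover have "algebraic_int (poly (map_poly of_int q) x)"
    using alg by (auto simp: poly_altdef intro!: algebraic_int_closed)
  ultimately have "of_int a \<in> I"
    using ideal_integers[OF I(1)] x by simp
  then have "of_nat (nat \<bar>a\<bar>) \<in> I"
    using ideal_integers_minus[OF I(1), of "of_int a"] by (cases "a \<ge> 0") auto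
  with a show ?thesis
    by (intro that[of "nat \<bar>a\<bar>"]) auto
qed

section \<open>Integral bases and arithmetic modulo a positive integer\<close>

lemma integral_basis_span:
  fixes w :: "nat \<Rightarrow> 'a::field_char_0"
  assumes "integral_basis n w"
  shows "algebraic_int x \<longleftrightarrow> (\<exists>c. x = (\<Sum>i=1..n. of_int (c i) * w i))"
proof -
  let ?f = "\<lambda>c. \<Sum>i=1..n. of_int (c i) * w i"
  have img: "?f ` ({1..n} \<rightarrow>\<^sub>E UNIV) = {x. algebraic_int x}"
    using assms by (simp add: integral_basis_def bij_betw_def ring_of_integers_def)
  \<comment> \<open>The basis is defined through coefficient functions that are fixed outside
    \<open>{1..n}\<close>; restricting an arbitrary \<open>c\<close> does not change the
    sum.\<close>
  have "?f c \<in> ?f ` ({1..n} \<rightarrow>\<^sub>E UNIV)" for c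
    by (rule image_eqI[of _ _ "restrict c {1..n}"]) auto
  with img show ?thesis
    by (metis (mono_tags, lifting) imageE mem_Collect_eq)
qed

lemma integral_basis_algebraic_int:
  fixes w :: "nat \<Rightarrow> 'a::field_char_0"
  assumes "integral_basis n w" "i \<in> {1..n}"
  shows "algebraic_int (w i)"
  unfolding integral_basis_span[OF assms(1)]
proof
  have "(\<Sum>j=1..n. of_int (if j = i then 1 else 0) * w j) = (\<Sum>j=1..n. if j = i then w j else 0)"
    by (rule sum.cong) auto
  then show "w i = (\<Sum>j=1..n. of_int (if j = i then 1 else 0) * w j)"
    using assms by simp
qed

text \<open>Finiteness of the quotient by \<open>k\<close>: an element is determined modulo
  \<open>k\<close> by its coordinates modulo \<open>k\<close>, so some residue vector occurs twice
  in any infinite sequence.\<close>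

lemma integers_mod_nat_pigeonhole:
  fixes f w :: "nat \<Rightarrow> 'a::field_char_0"
  assumes basis: "integral_basis n w" and k: "k > 0" and alg: "\<And>i. algebraic_int (f i)"
  obtains i j where "i < j" "f j - f i \<in> PIdl\<^bsub>ring_of_integers\<^esub> (of_nat k)"
proof -
  have "\<forall>i. \<exists>c. f i = (\<Sum>l=1..n. of_int (c l) * w l)"
    using alg integral_basis_span[OF basis] by blast
  then obtain c where c: "\<And>i. f i = (\<Sum>l=1..n. of_int (c i l) * w l)"
    by metis
  define r where "r i = restrict (\<lambda>l. c i l mod int k) {1..n}" for i
  have "range r \<subseteq> {1..n} \<rightarrow>\<^sub>E {0..<int k}"
    using k by (auto simp: r_def)
  then have "finite (range r)"
    by (rule finite_subset) (simp add: finite_PiE)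
  then have "\<not> inj r"
    using finite_imageD by blast
  then obtain i j where ij: "i < j" "r i = r j"
    by (metis injI linorder_neqE_nat)
  have dvd: "int k dvd c j l - c i l" if "l \<in> {1..n}" for l
    using ij(2) that by (auto simp: r_def mod_eq_dvd_iff dvd_diff_commute dest!: fun_cong[where x = l])
  have "f j - f i = (\<Sum>l=1..n. of_int (c j l - c i l) * w l)"
    by (simp add: c sum_subtractf left_diff_distrib)
  also have "\<dots> = (\<Sum>l=1..n. of_int ((c j l - c i l) div int k) * w l * of_nat k)"
  proof (rule sum.cong)
    fix l assume "l \<in> {1..n}"
    then have "c j l - c i l = (c j l - c i l) div int k * int k"
      using dvd by simp
    then have "(of_int (c j l - c i l) :: 'a) = of_int ((c j l - c i l) div int k) * of_nat k"
      by (metis of_int_mult of_int_of_nat_eq)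
    then show "of_int (c j l - c i l) * w l = of_int ((c j l - c i l) div int k) * w l * of_nat k"
      by (simp add: mult_ac)
  qed simp
  also have "\<dots> = (\<Sum>l=1..n. of_int ((c j l - c i l) div int k) * w l) * of_nat k"
    by (simp add: sum_distrib_right)
  finally have "f j - f i \<in> PIdl\<^bsub>ring_of_integers\<^esub> (of_nat k)"
    using integral_basis_span[OF basis] by (auto simp: PIdl_ring_of_integers)
  with ij(1) that show ?thesis
    by blast
qed

text \<open>The powers of \<open>a\<close> modulo \<open>k\<close> are periodic from some exponent
  \<open>i\<close> on. For a multiple \<open>N\<close> of the period with \<open>N \<ge> i\<close>,
  the exponents \<open>N\<close> and \<open>2 * N\<close> give the same residue.\<close>

lemma power_idempotent_mod:
  fixes a :: "'a::field_char_0" and w :: "nat \<Rightarrow> 'a"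
  assumes basis: "integral_basis n w" and k: "k > 0" and a: "algebraic_int a"
  obtains N where "N > 0" "a ^ N * a ^ N - a ^ N \<in> PIdl\<^bsub>ring_of_integers\<^esub> (of_nat k)"
proof -
  let ?J = "PIdl\<^bsub>ring_of_integers\<^esub> (of_nat k :: 'a)"
  have J: "ideal ?J ring_of_integers"
    by (intro ideal_PIdl algebraic_int_closed)
  obtain i j where ij: "i < j" "a ^ j - a ^ i \<in> ?J"
    using integers_mod_nat_pigeonhole[OF basis k, of "\<lambda>i. a ^ i"] a algebraic_int_power by blast
  define p where "p = j - i"
  have p: "p > 0" "j = i + p"
    using ij by (auto simp: p_def)
  have step: "a ^ (r + p) - a ^ r \<in> ?J" if "r \<ge> i" for r
  proof -
    have "a ^ (r - i) * (a ^ j - a ^ i) = a ^ (r + p) - a ^ r"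
      using that p by (simp add: right_diff_distrib flip: power_add)
    then show ?thesis
      using ideal_integers_mult_left[OF J algebraic_int_power[OF a] ij(2), of "r - i"] by simp
  qed
  have periodic: "a ^ (r + l * p) - a ^ r \<in> ?J" if "r \<ge> i" for r l
  proof (induction l)
    case 0
    show ?case
      using ideal_integers_0[OF J] by simp
  next
    case (Suc l)
    have "a ^ (r + Suc l * p) - a ^ r
        = (a ^ (r + l * p + p) - a ^ (r + l * p)) + (a ^ (r + l * p) - a ^ r)"
      by (simp add: add_ac)
    also have "\<dots> \<in> ?J"
      using that by (intro ideal_integers_add[OF J] step Suc) simp
    finally show ?case .
  qed
  \<comment> \<open>The factor \<open>Suc i\<close> instead of \<open>i\<close> keeps the exponent
    positive when \<open>i = 0\<close>.\<close>
  have "i \<le> Suc i * p"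
    using p by (metis Suc_leD le_square mult_le_mono2 nat_mult_1_right Suc_leI One_nat_def le_SucI mult.commute)
  from periodic[OF this, of "Suc i"] show ?thesis
    using p by (intro that[of "Suc i * p"]) (auto simp: power_add)
qed

text \<open>With \<open>e\<close> an idempotent power of \<open>a\<close>, the element \<open>a + (1 - e) c\<close> is a unit on both
  factors: on the \<open>e\<close>-part it is the unit \<open>a\<close>, on the \<open>(1 - e)\<close>-part \<open>a\<close> is nilpotent, so
  \<open>c\<close> is a unit there.\<close>

lemma stable_range_mod:
  fixes a b c d :: "'a::field_char_0" and w :: "nat \<Rightarrow> 'a"
  assumes basis: "integral_basis n w" and k: "k > 0"
    and alg: "algebraic_int a" "algebraic_int b" "algebraic_int c" "algebraic_int d"
    and det: "a * d - b * c = 1"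
  obtains t v where "algebraic_int t" "algebraic_int v"
    "(a + t * c) * v - 1 \<in> PIdl\<^bsub>ring_of_integers\<^esub> (of_nat k)"
proof -
  let ?J = "PIdl\<^bsub>ring_of_integers\<^esub> (of_nat k :: 'a)"
  have J: "ideal ?J ring_of_integers"
    by (intro ideal_PIdl algebraic_int_closed)
  obtain N where N: "N > 0" "a ^ N * a ^ N - a ^ N \<in> ?J"
    using power_idempotent_mod[OF basis k alg(1)] by blast
  \<comment> \<open>By the determinant, \<open>(a + c) * (- b) = 1 - a * s\<close>. Where
    \<open>e\<close> vanishes, \<open>a * s\<close> is nilpotent and the geometric sum
    \<open>S\<close> inverts \<open>1 - a * s\<close>.\<close>
  define P e s q S where "P = a ^ (N - 1)" and "e = a ^ N" and "s = d + b" and "q = s ^ N"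
    and "S = (\<Sum>i<N. (a * s) ^ i)"
  have e: "e = a * P"
    using N(1) by (cases N) (auto simp: e_def P_def)
  have S: "(1 - a * s) * S = 1 - e * q"
    by (simp only: S_def e_def q_def flip: one_diff_power_eq power_mult_distrib)
  \<comment> \<open>This glues two partial inverses: \<open>P\<close> on the \<open>e\<close>-part,
    where \<open>a * P = e\<close> acts as 1, and \<open>- b * S\<close> on the other part. The
    shift used is \<open>t = 1 - e\<close>.\<close>
  define v where "v = P * e - b * (1 - e) * S"
  have algs: "algebraic_int P" "algebraic_int e" "algebraic_int q" "algebraic_int S"
    unfolding P_def e_def q_def S_def s_def by (intro algebraic_int_closed alg)+
  have "(a + (1 - e) * c) * (P * e) = a * P * e + (1 - e) * e * c * P"
    by (simp add: algebra_simps)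
  also have "\<dots> = e + (e * e - e) * (1 - c * P)"
    unfolding e[symmetric] by (simp add: algebra_simps)
  finally have 1: "(a + (1 - e) * c) * (P * e) = \<dots>" .
  have "(a + (1 - e) * c) * (b * (1 - e))
      = (e * e - e) * b * c - (1 - e) * (1 - a * s) - (1 - e) * (a * d - b * c - 1)"
    by (simp add: s_def algebra_simps)
  then have "(a + (1 - e) * c) * (b * (1 - e) * S)
      = (e * e - e) * b * c * S - (1 - e) * ((1 - a * s) * S)"
    by (simp add: det left_diff_distrib flip: mult.assoc)
  also have "\<dots> = (e * e - e) * (b * c * S - q) - (1 - e)"
    unfolding S by (simp add: algebra_simps)
  finally have 2: "(a + (1 - e) * c) * (b * (1 - e) * S) = \<dots>" .
  have "(a + (1 - e) * c) * v - 1 = (e * e - e) * (1 - c * P + q - b * c * S)"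
    unfolding v_def right_diff_distrib[of "a + _"] 1 2 by (simp add: algebra_simps)
  also have "\<dots> \<in> ?J"
    using N(2) unfolding e_def[symmetric]
    by (intro ideal_integers_mult_right[OF J] algebraic_int_closed algs alg)
  finally show ?thesis
    by (intro that[of "1 - e" v]) (auto simp: v_def intro!: algebraic_int_closed algs alg)
qed

section \<open>Matrices over the ring of integers\<close>

hide_const (open) Matrix.mat Matrix.vec Determinant.det
no_notation vec_index (infixl \<open>$\<close> 100)

text \<open>Naming the four entries turns matrix equations into ring identities that the simplifier
  can settle.\<close>

definition mat2 :: "'a \<Rightarrow> 'a \<Rightarrow> 'a \<Rightarrow> 'a \<Rightarrow> 'a::field_char_0 ^ 2 ^ 2" where
  "mat2 a b c d = vector [vector [a, b], vector [c, d]]"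

lemma mat2_nth [simp]:
  "mat2 a b c d $ 1 $ 1 = a" "mat2 a b c d $ 1 $ 2 = b"
  "mat2 a b c d $ 2 $ 1 = c" "mat2 a b c d $ 2 $ 2 = d"
  by (simp_all add: mat2_def vector_2)

lemma mat2_cases:
  obtains a b c d where "A = mat2 a b c d"
proof
  show "A = mat2 (A $ 1 $ 1) (A $ 1 $ 2) (A $ 2 $ 1) (A $ 2 $ 2)"
    by (simp add: Finite_Cartesian_Product.vec_eq_iff forall_2)
qed

lemma mat2_eq_iff [simp]: "mat2 a b c d = mat2 a' b' c' d' \<longleftrightarrow> a = a' \<and> b = b' \<and> c = c' \<and> d = d'"
  by (metis mat2_nth)

lemma mat2_mult [simp]:
  "mat2 a b c d ** mat2 a' b' c' d'
    = mat2 (a * a' + b * c') (a * b' + b * d') (c * a' + d * c') (c * b' + d * d')"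
  by (simp add: Finite_Cartesian_Product.vec_eq_iff forall_2 matrix_matrix_mult_def sum_2)

lemma mat2_minus [simp]: "- mat2 a b c d = mat2 (- a) (- b) (- c) (- d)"
  by (simp add: Finite_Cartesian_Product.vec_eq_iff forall_2)

lemma mat_1_eq_mat2: "mat 1 = mat2 1 0 0 1"
  by (simp add: Finite_Cartesian_Product.vec_eq_iff forall_2 Finite_Cartesian_Product.mat_def)

lemma elem_T_eq_mat2: "elem_T x = mat2 1 x 0 1"
  and elem_S_eq_mat2: "elem_S = mat2 0 1 (- 1) 0"
  by (simp_all add: elem_T_def elem_S_def mat2_def)

lemma elem_T_add: "elem_T (x + y) = elem_T x ** elem_T y"
  by (simp add: elem_T_eq_mat2)

lemma mat2_in_SL2_iff:
  "mat2 a b c d \<in> carrier SL2 \<longleftrightarrow>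
    algebraic_int a \<and> algebraic_int b \<and> algebraic_int c \<and> algebraic_int d \<and> a * d - b * c = 1"
  by (auto simp: SL2_def ring_of_integers_def forall_2 det_2)

lemma mat_cong_mat2_iff:
  "mat_cong I (mat2 a b c d) (mat2 a' b' c' d') \<longleftrightarrow>
    a - a' \<in> I \<and> b - b' \<in> I \<and> c - c' \<in> I \<and> d - d' \<in> I"
  by (auto simp: mat_cong_def forall_2)

lemma mat_cong_mult:
  assumes J: "ideal J ring_of_integers" and cong: "mat_cong J A B"
    and P: "P \<in> carrier SL2" and Q: "Q \<in> carrier SL2"
  shows "mat_cong J (P ** A ** Q) (P ** B ** Q)"
proof -
  obtain a b c d where A: "A = mat2 a b c d" by (rule mat2_cases)
  obtain a' b' c' d' where B: "B = mat2 a' b' c' d'" by (rule mat2_cases)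
  obtain p q r s where P': "P = mat2 p q r s" by (rule mat2_cases)
  obtain p' q' r' s' where Q': "Q = mat2 p' q' r' s'" by (rule mat2_cases)
  have cong': "a - a' \<in> J" "b - b' \<in> J" "c - c' \<in> J" "d - d' \<in> J"
    using cong by (simp_all add: A B mat_cong_mat2_iff)
  have alg: "algebraic_int p" "algebraic_int q" "algebraic_int r" "algebraic_int s"
    "algebraic_int p'" "algebraic_int q'" "algebraic_int r'" "algebraic_int s'"
    using P Q by (simp_all add: P' Q' mat2_in_SL2_iff)
  have entry: "(x * a + y * c) * z + (x * b + y * d) * u - ((x * a' + y * c') * z + (x * b' + y * d') * u) \<in> J"
    if "algebraic_int x" "algebraic_int y" "algebraic_int z" "algebraic_int u" for x y z u
  proof -
    \<comment> \<open>This is an entry of P(A - B)Q, with \<open>x\<close>, \<open>y\<close> a row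
      of \<open>P\<close> and \<open>z\<close>, \<open>u\<close> a column of
      \<open>Q\<close>.\<close>
    have "(x * (a - a') + y * (c - c')) * z + (x * (b - b') + y * (d - d')) * u \<in> J"
      by (intro ideal_integers[OF J] cong' that)
    then show ?thesis
      by (simp add: algebra_simps)
  qed
  show ?thesis
    unfolding A B P' Q' mat2_mult mat_cong_mat2_iff by (intro conjI entry alg)
qed

lemma mat_cong_minus:
  assumes J: "ideal J ring_of_integers" and cong: "mat_cong J A (- B)"
  shows "mat_cong J (- A) B"
  unfolding mat_cong_def
proof (intro allI)
  fix i j
  have "- (A $ i $ j - (- B) $ i $ j) \<in> J"
    using cong by (intro ideal_integers_minus[OF J]) (auto simp: mat_cong_def)
  then show "(- A) $ i $ j - B $ i $ j \<in> J"
    by simp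
qed

section \<open>The group SL(2) over the ring of integers and reduction of its congruence
  matrices\<close>

lemma SL2_simps [simp]:
  "A \<otimes>\<^bsub>SL2\<^esub> B = A ** B" "\<one>\<^bsub>SL2\<^esub> = mat 1"
  by (simp_all add: SL2_def)

lemma mat_1_in_SL2: "mat 1 \<in> carrier SL2"
  by (simp add: mat_1_eq_mat2 mat2_in_SL2_iff algebraic_int_1)

lemma group_SL2: "Group.group (SL2 :: ('a::field_char_0 ^ 2 ^ 2) monoid)"
proof (rule groupI)
  fix A B :: "'a ^ 2 ^ 2"
  assume "A \<in> carrier SL2" "B \<in> carrier SL2"
  moreover have "(A ** B) $ i $ j = (\<Sum>l\<in>UNIV. A $ i $ l * B $ l $ j)" for i j
    by (simp add: matrix_matrix_mult_def)
  ultimately show "A \<otimes>\<^bsub>SL2\<^esub> B \<in> carrier SL2"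
    by (auto simp: SL2_def det_mul ring_of_integers_def intro!: algebraic_int_closed)
next
  fix A :: "'a ^ 2 ^ 2"
  assume A: "A \<in> carrier SL2"
  obtain a b c d where eq: "A = mat2 a b c d" by (rule mat2_cases)
  show "\<exists>B\<in>carrier SL2. B \<otimes>\<^bsub>SL2\<^esub> A = \<one>\<^bsub>SL2\<^esub>"
  proof (rule bexI)
    show "mat2 d (- b) (- c) a \<in> carrier SL2"
      using A by (auto simp: eq mat2_in_SL2_iff algebra_simps)
    show "mat2 d (- b) (- c) a \<otimes>\<^bsub>SL2\<^esub> A = \<one>\<^bsub>SL2\<^esub>"
      using A by (auto simp: eq mat2_in_SL2_iff mat_1_eq_mat2 algebra_simps)
  qed
qed (auto simp: matrix_mul_assoc mat_1_in_SL2)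

lemma elem_T_in_SL2: "algebraic_int x \<Longrightarrow> elem_T x \<in> carrier SL2"
  and elem_S_in_SL2: "elem_S \<in> carrier SL2"
  by (simp_all add: elem_T_eq_mat2 elem_S_eq_mat2 mat2_in_SL2_iff)

text \<open>Stable range makes the upper left entry a unit modulo \<open>k\<close> after conjugation
  by some \<open>elem_T t\<close>; a matrix of determinant 1 with such an entry can be matched by
  elementary factors with entries in \<open>I\<close>. The set \<open>N\<close> will be the preimage
  of the normal core of \<open>K\<close>.\<close>

lemma congruent_to_elementary:
  fixes w :: "nat \<Rightarrow> 'a::field_char_0" and A :: "'a ^ 2 ^ 2"
  assumes basis: "integral_basis n w" and k: "k > 0" and I: "ideal I ring_of_integers"
    and mult: "\<And>A B. A \<in> N \<Longrightarrow> B \<in> N \<Longrightarrow> A ** B \<in> N"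
    and conj_T: "\<And>A x. A \<in> N \<Longrightarrow> algebraic_int x \<Longrightarrow> elem_T x ** A ** elem_T (- x) \<in> N"
    and conj_S: "\<And>A. A \<in> N \<Longrightarrow> elem_S ** A ** (- elem_S) \<in> N"
    and T: "\<And>x. x \<in> I \<Longrightarrow> elem_T x \<in> N"
    and A: "A \<in> carrier SL2" and A_cong: "mat_cong I A (mat 1)"
  shows "\<exists>B\<in>N. mat_cong (PIdl\<^bsub>ring_of_integers\<^esub> (of_nat k)) A B"
proof -
  let ?J = "PIdl\<^bsub>ring_of_integers\<^esub> (of_nat k :: 'a)"
  have J: "ideal ?J ring_of_integers"
    by (intro ideal_PIdl algebraic_int_closed)
  obtain a b c d where A_eq: "A = mat2 a b c d" by (rule mat2_cases)
  have alg: "algebraic_int a" "algebraic_int b" "algebraic_int c" "algebraic_int d"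
    and det: "a * d - b * c = 1"
    using A by (simp_all add: A_eq mat2_in_SL2_iff)
  have inI: "a - 1 \<in> I" "b \<in> I" "c \<in> I" "d - 1 \<in> I"
    using A_cong by (simp_all add: A_eq mat_1_eq_mat2 mat_cong_mat2_iff)
  obtain t v where tv: "algebraic_int t" "algebraic_int v" "(a + t * c) * v - 1 \<in> ?J"
    by (rule stable_range_mod[OF basis k alg det])
  \<comment> \<open>\<open>1 + j\<close>, \<open>b'\<close>, \<open>c\<close>, \<open>d'\<close> are
    the entries of the conjugate of \<open>A\<close> by \<open>elem_T t\<close>, and
    \<open>e\<close> is the error of \<open>v\<close> as an inverse of \<open>1 + j\<close>.\<close>
  define j b' d' e where "j = a + t * c - 1" and "b' = b + t * d - t * (a + t * c)"
    and "d' = d - t * c" and "e = (1 + j) * v - 1"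
  have j: "j \<in> I"
  proof -
    have "(a - 1) + t * c \<in> I"
      by (intro ideal_integers[OF I] inI tv)
    then show ?thesis
      by (simp add: j_def algebra_simps)
  qed
  have b': "b' \<in> I"
  proof -
    \<comment> \<open>Neither \<open>a\<close> nor \<open>d\<close> need lie in \<open>I\<close>,
      but their difference does, since both are 1 modulo \<open>I\<close>.\<close>
    have "b + t * ((d - 1) - (a - 1)) - t * (t * c) \<in> I"
      by (intro ideal_integers[OF I] inI tv)
    then show ?thesis
      by (simp add: b'_def algebra_simps)
  qed
  have e: "e \<in> ?J"
    using tv by (simp add: e_def j_def)
  have algs: "algebraic_int j" "algebraic_int b'" "algebraic_int d'" "algebraic_int e"
    unfolding j_def b'_def d'_def e_def by (intro algebraic_int_closed alg tv)+
  have conj: "elem_T t ** A ** elem_T (- t) = mat2 (1 + j) b' c d'"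
    by (simp add: A_eq elem_T_eq_mat2 j_def b'_def d'_def algebra_simps)
  have det': "(1 + j) * d' - b' * c = 1"
    using det by (simp add: j_def b'_def d'_def algebra_simps)
  have L: "mat2 1 0 x 1 \<in> N" if "x \<in> I" for x
  proof -
    have "elem_S ** elem_T (- x) ** (- elem_S) \<in> N"
      using that by (intro conj_S T ideal_integers[OF I])
    then show ?thesis
      by (simp add: elem_S_eq_mat2 elem_T_eq_mat2)
  qed
  \<comment> \<open>The conjugate of \<open>A\<close> and the conjugate \<open>[1 + j, - j; j, 1 - j]\<close> of an elementary matrix have
    the same unit corner \<open>1 + j\<close>, so modulo \<open>k\<close> both reduce to the same diagonal matrix.\<close>
  let ?p = "(c - j) * v" and ?q = "(b' + j) * v"
  \<comment> \<open>Modulo \<open>k\<close>, the left factor changes the lower left entry from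
    \<open>j\<close> to \<open>c\<close>, and the right factor changes the upper right entry from
    \<open>- j\<close> to \<open>b'\<close>.\<close>
  define M where "M = mat2 1 0 ?p 1 ** (elem_T 1 ** mat2 1 0 j 1 ** elem_T (- 1)) ** elem_T ?q"
  have "M \<in> N"
    unfolding M_def by (intro mult L T conj_T ideal_integers[OF I] j b' inI tv algebraic_int_closed)
  moreover have "mat_cong ?J (mat2 (1 + j) b' c d') M"
  proof -
    define m where "m = ?p * ((1 + j) * ?q - j) + j * ?q + 1 - j"
    have M_eq: "M = mat2 (1 + j) ((1 + j) * ?q - j) (?p * (1 + j) + j) m"
      by (simp add: M_def m_def elem_T_eq_mat2 algebra_simps)
    have "b' - ((1 + j) * ?q - j) = - (e * (b' + j))" "c - (?p * (1 + j) + j) = - (e * (c - j))"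
      by (simp_all add: e_def algebra_simps)
    \<comment> \<open>With determinant 1 and a corner invertible modulo \<open>k\<close>, the other
      entries determine the last one. The identity records the explicit error; its final term
      vanishes by \<open>det'\<close>.\<close>
    moreover have "d' - m = e * (m - d' - v * (b' * (c - j) + (b' + j) * c + e * (b' + j) * (c - j)))
        + v * ((1 + j) * d' - b' * c - 1)"
      by (simp add: m_def e_def algebra_simps)
    then have "d' - m = e * (m - d' - v * (b' * (c - j) + (b' + j) * c + e * (b' + j) * (c - j)))"
      by (simp add: det')
    moreover have "algebraic_int m"
      unfolding m_def by (intro algebraic_int_closed algs alg tv)
    ultimately show ?thesis
      unfolding M_eq mat_cong_mat2_iff
      by (auto intro!: ideal_integers_0[OF J] ideal_integers_minus[OF J]
          ideal_integers_mult_right[OF J _ e] algebraic_int_closed algs alg tv)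
  qed
  ultimately have "elem_T (- t) ** M ** elem_T t \<in> N"
    and "mat_cong ?J (elem_T (- t) ** mat2 (1 + j) b' c d' ** elem_T t) (elem_T (- t) ** M ** elem_T t)"
    using conj_T[of M "- t"] tv(1) by (auto intro!: mat_cong_mult J elem_T_in_SL2)
  moreover have "elem_T (- t) ** mat2 (1 + j) b' c d' ** elem_T t = A"
    by (simp add: A_eq elem_T_eq_mat2 j_def b'_def d'_def algebra_simps)
  ultimately show ?thesis
    by metis
qed

section \<open>Normal cores of subgroups of finite index\<close>

text \<open>The intersection of all conjugates of \<open>K\<close>, described elementwise.\<close>

definition normal_core :: "('g, 'b) monoid_scheme \<Rightarrow> 'g set \<Rightarrow> 'g set" where
  "normal_core G K = {g \<in> carrier G. \<forall>x\<in>carrier G. x \<otimes>\<^bsub>G\<^esub> g \<otimes>\<^bsub>G\<^esub> inv\<^bsub>G\<^esub> x \<in> K}"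

context Group.group
begin

lemma normal_core_subset: "normal_core G K \<subseteq> K"
proof
  fix g assume "g \<in> normal_core G K"
  then have "g \<in> carrier G" "\<one> \<otimes> g \<otimes> inv \<one> \<in> K"
    using one_closed unfolding normal_core_def by blast+
  then show "g \<in> K"
    by simp
qed

lemma inv_mult_cancel_left:
  assumes "x \<in> carrier G" "y \<in> carrier G"
  shows "inv x \<otimes> (x \<otimes> y) = y"
  using assms m_assoc[of "inv x" x y] by simp

lemma normal_core_normal:
  assumes K: "subgroup K G"
  shows "normal_core G K \<lhd> G"
  unfolding normal_inv_iff
proof (intro conjI ballI)
  show "subgroup (normal_core G K) G"
  proof (rule subgroupI)
    show "normal_core G K \<noteq> {}"
      using subgroup.one_closed[OF K] by (auto simp: normal_core_def)
  next
    fix g assume g: "g \<in> normal_core G K"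
    have "x \<otimes> inv g \<otimes> inv x \<in> K" if x: "x \<in> carrier G" for x
    proof -
      have "inv (x \<otimes> g \<otimes> inv x) \<in> K"
        using g x subgroup.m_inv_closed[OF K] by (auto simp: normal_core_def)
      then show ?thesis
        using g x by (simp add: normal_core_def inv_mult_group m_assoc)
    qed
    with g show "inv g \<in> normal_core G K"
      by (auto simp: normal_core_def)
  next
    fix g h assume gh: "g \<in> normal_core G K" "h \<in> normal_core G K"
    have "x \<otimes> (g \<otimes> h) \<otimes> inv x \<in> K" if x: "x \<in> carrier G" for x
    proof -
      have "x \<otimes> (g \<otimes> h) \<otimes> inv x = (x \<otimes> g \<otimes> inv x) \<otimes> (x \<otimes> h \<otimes> inv x)"
        using gh x by (simp add: normal_core_def m_assoc inv_mult_cancel_left)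
      then show ?thesis
        using gh x subgroup.m_closed[OF K] by (auto simp: normal_core_def)
    qed
    with gh show "g \<otimes> h \<in> normal_core G K"
      by (auto simp: normal_core_def)
  qed (auto simp: normal_core_def)
next
  fix y g assume yg: "y \<in> carrier G" "g \<in> normal_core G K"
  have "x \<otimes> (y \<otimes> g \<otimes> inv y) \<otimes> inv x \<in> K" if x: "x \<in> carrier G" for x
  proof -
    have "x \<otimes> (y \<otimes> g \<otimes> inv y) \<otimes> inv x = (x \<otimes> y) \<otimes> g \<otimes> inv (x \<otimes> y)"
      using yg x by (simp add: normal_core_def m_assoc inv_mult_group)
    then show ?thesis
      using yg x by (simp add: normal_core_def)
  qed
  with yg show "y \<otimes> g \<otimes> inv y \<in> normal_core G K"
    by (auto simp: normal_core_def)
qed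

text \<open>This turns the condition in the definition of the level into membership of the
  generators in one fixed normal subgroup.\<close>

lemma normal_closure_subset_iff:
  assumes K: "subgroup K G" and H: "H \<subseteq> carrier G"
  shows "normal_closure G H \<subseteq> K \<longleftrightarrow> H \<subseteq> normal_core G K"
proof
  assume "H \<subseteq> normal_core G K"
  then have "normal_closure G H \<subseteq> normal_core G K"
    unfolding normal_closure_def by (intro hull_minimal normal_core_normal K)
  with normal_core_subset show "normal_closure G H \<subseteq> K"
    by blast
next
  assume sub: "normal_closure G H \<subseteq> K"
  \<comment> \<open>The hull is an intersection of normal subgroups containing \<open>H\<close>, and
    each of them contains the conjugates of \<open>H\<close>.\<close>
  have "x \<otimes> h \<otimes> inv x \<in> normal_closure G H" if "h \<in> H" "x \<in> carrier G" for h x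
    unfolding normal_closure_def hull_def
  proof safe
    fix N assume N: "N \<lhd> G" "H \<subseteq> N"
    show "x \<otimes> h \<otimes> inv x \<in> N"
      using that N(2) by (intro normal.inv_op_closed2[OF N(1)]) auto
  qed
  with sub H show "H \<subseteq> normal_core G K"
    unfolding normal_core_def by blast
qed

text \<open>Two of the powers with exponents from 0 to the index share a coset, so some
  \<open>g [^] (j - i)\<close> lies in \<open>K\<close>; the exponent \<open>j - i\<close> is at
  most the index and divides its factorial.\<close>

lemma pow_fact_card_rcosets_in_subgroup:
  assumes K: "subgroup K G" and fin: "finite (rcosets K)" and g: "g \<in> carrier G"
  shows "g [^] (fact (card (rcosets K)) :: nat) \<in> K"
proof -
  let ?c = "card (rcosets K)"
  let ?f = "\<lambda>i::nat. K #> (g [^] i)"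
  have "?f ` {0..?c} \<subseteq> rcosets K"
    using K g by (auto intro!: rcosetsI subgroup.subset)
  then have "card (?f ` {0..?c}) \<le> ?c"
    by (rule card_mono[OF fin])
  then have "\<not> inj_on ?f {0..?c}"
    by (intro pigeonhole) simp
  then obtain i j where ij: "i < j" "j \<le> ?c" "?f i = ?f j"
    unfolding inj_on_def by (metis atLeastAtMost_iff linorder_neqE_nat)
  have "g [^] j \<in> K #> (g [^] i)"
    using ij(3) rcos_self[OF _ K] g by simp
  then have "g [^] j \<otimes> inv (g [^] i) \<in> K"
    using g by (simp add: subgroup.rcos_module_imp[OF K group_axioms])
  moreover have "g [^] j = g [^] (j - i) \<otimes> g [^] i"
    using ij g by (simp add: nat_pow_mult)
  ultimately have K_pow: "g [^] (j - i) \<in> K"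
    using g by (simp add: m_assoc)
  have "j - i dvd fact ?c"
    using ij by (intro dvd_fact) auto
  then obtain l where "fact ?c = (j - i) * l"
    by blast
  then have "g [^] (fact ?c :: nat) = (g [^] (j - i)) [^] l"
    using g by (simp add: nat_pow_pow)
  moreover have "(g [^] (j - i)) [^] l \<in> K"
    using K_pow by (induction l) (simp_all add: subgroup.one_closed[OF K] subgroup.m_closed[OF K])
  ultimately show ?thesis
    by simp
qed

lemma conj_nat_pow:
  assumes "x \<in> carrier G" "g \<in> carrier G"
  shows "(x \<otimes> g \<otimes> inv x) [^] (n::nat) = x \<otimes> g [^] n \<otimes> inv x"
proof (induction n)
  case (Suc n)
  then show ?case
    using assms by (simp add: m_assoc inv_mult_cancel_left)
qed (use assms in simp)

text \<open>The exponent does not depend on \<open>g\<close>, so it serves all conjugates of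
  \<open>g\<close> at once.\<close>

lemma pow_fact_card_rcosets_in_normal_core:
  assumes "subgroup K G" "finite (rcosets K)" "g \<in> carrier G"
  shows "g [^] (fact (card (rcosets K)) :: nat) \<in> normal_core G K"
proof -
  have "x \<otimes> g [^] (fact (card (rcosets K)) :: nat) \<otimes> inv x \<in> K" if "x \<in> carrier G" for x
    unfolding conj_nat_pow[OF that assms(3), symmetric]
    using assms that by (intro pow_fact_card_rcosets_in_subgroup) auto
  with assms(3) show ?thesis
    by (simp add: normal_core_def)
qed

end

text \<open>Used to pass from the \<open>elem_T (w i)\<close> to all \<open>elem_T x\<close>;
  negation takes care of the negative coefficients.\<close>

lemma integral_basis_induct:
  fixes w :: "nat \<Rightarrow> 'a::field_char_0"
  assumes basis: "integral_basis n w" and x: "algebraic_int x"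
    and base: "\<And>i. i \<in> {1..n} \<Longrightarrow> P (w i)" and zero: "P 0"
    and add: "\<And>x y. algebraic_int x \<Longrightarrow> algebraic_int y \<Longrightarrow> P x \<Longrightarrow> P y \<Longrightarrow> P (x + y)"
    and minus: "\<And>x. algebraic_int x \<Longrightarrow> P x \<Longrightarrow> P (- x)"
  shows "P x"
proof -
  let ?Q = "\<lambda>x. algebraic_int x \<and> P x"
  have nat: "?Q (of_nat l * w i)" if "i \<in> {1..n}" for i l
    by (induction l)
      (use that zero in \<open>auto simp: distrib_right intro!: add base integral_basis_algebraic_int[OF basis]
        algebraic_int_closed\<close>)
  have int: "?Q (of_int l * w i)" if "i \<in> {1..n}" for i l
  proof (cases l rule: int_cases)
    case (nonneg m)
    then show ?thesis
      using nat[OF that] by simp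
  next
    case (neg m)
    then show ?thesis
      using minus[of "of_nat (Suc m) * w i"] nat[OF that, of "Suc m"] algebraic_int_minus
      by (simp del: of_nat_Suc flip: of_nat_Suc)
  qed
  obtain c where "x = (\<Sum>i=1..n. of_int (c i) * w i)"
    using x integral_basis_span[OF basis] by blast
  moreover have sum: "?Q (sum f J)" if "\<And>i. i \<in> J \<Longrightarrow> ?Q (f i)" for J and f :: "nat \<Rightarrow> 'a"
    using that by (induction J rule: infinite_finite_induct) (simp_all add: zero add algebraic_int_add)
  ultimately show ?thesis
    using sum[of "{1..n}" "\<lambda>i. of_int (c i) * w i"] int by simp
qed

section \<open>Subgroups between the elementary group and \<open>SL\<^sub>2\<close>\<close>

text \<open>A common frame for SL(2) and for \<open>E\<close>: the argument uses only that the group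
  contains \<open>elem_S\<close> and every integral \<open>elem_T x\<close>.\<close>

locale elementary_overgroup =
  fixes C :: "('a::field_char_0 ^ 2 ^ 2) set"
  assumes subgroup_C: "subgroup C SL2"
    and elem_S_C: "elem_S \<in> C"
    and elem_T_C: "algebraic_int x \<Longrightarrow> elem_T x \<in> C"
begin

abbreviation "H \<equiv> SL2\<lparr>carrier := C\<rparr>"
abbreviation "G \<equiv> H Mod pm (mat 1)"

lemma C_subset: "C \<subseteq> carrier SL2"
  by (rule subgroup.subset[OF subgroup_C])

sublocale H: Group.group H
  by (rule subgroup.subgroup_is_group[OF subgroup_C group_SL2])

lemma minus_one_C: "- mat 1 \<in> C"
proof -
  have "elem_S ** elem_S = (- mat 1 :: 'a ^ 2 ^ 2)"
    by (simp add: elem_S_eq_mat2 mat_1_eq_mat2)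
  then show ?thesis
    using H.m_closed[of elem_S elem_S] elem_S_C by simp
qed

lemma minus_C: "A \<in> C \<Longrightarrow> - A \<in> C"
proof -
  assume "A \<in> C"
  moreover have "- mat 1 ** A = - A"
    by (rule mat2_cases[of A]) (simp add: mat_1_eq_mat2)
  ultimately show ?thesis
    using H.m_closed[of "- mat 1" A] minus_one_C by simp
qed

lemma minus_mat_mult: "(- A) ** B = - (A ** B)" "A ** (- B) = - (A ** B)"
  for A B :: "'a ^ 2 ^ 2"
  by (cases A rule: mat2_cases; cases B rule: mat2_cases; simp)+

lemma r_coset_pm: "pm (mat 1) #>\<^bsub>H\<^esub> A = pm A" "pm (mat 1) #>\<^bsub>SL2\<^esub> A = pm A"
  by (auto simp: r_coset_def pm_def minus_mat_mult)

lemma pm_normal: "pm (mat 1) \<lhd> H"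
proof (rule H.normalI)
  show "subgroup (pm (mat 1)) H"
  proof (rule H.subgroupI)
    show "pm (mat 1) \<subseteq> carrier H"
      using minus_one_C H.one_closed by (auto simp: pm_def)
    fix A :: "'a ^ 2 ^ 2" assume "A \<in> pm (mat 1)"
    moreover have "inv\<^bsub>H\<^esub> (- mat 1) = - mat 1"
      by (rule H.inv_equality) (use minus_one_C in \<open>auto simp: minus_mat_mult\<close>)
    ultimately show "inv\<^bsub>H\<^esub> A \<in> pm (mat 1)"
      using H.inv_one by (auto simp: pm_def)
  qed (auto simp: pm_def minus_mat_mult)
  show "\<forall>A\<in>carrier H. pm (mat 1) #>\<^bsub>H\<^esub> A = A <#\<^bsub>H\<^esub> pm (mat 1)"
    by (auto simp: r_coset_pm) (auto simp: l_coset_def pm_def minus_mat_mult)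
qed

lemma carrier_G: "carrier G = pm ` C"
  by (simp add: carrier_FactGroup r_coset_pm)

lemma pm_hom: "pm \<in> hom H G"
  using normal.r_coset_hom_Mod[OF pm_normal] by (simp add: r_coset_pm)

sublocale G: Group.group G
  by (rule normal.factorgroup_is_group[OF pm_normal])

lemma pm_mult: "A \<in> C \<Longrightarrow> B \<in> C \<Longrightarrow> pm (A ** B) = pm A \<otimes>\<^bsub>G\<^esub> pm B"
  using hom_mult[OF pm_hom] by simp

lemma pm_in_G: "A \<in> C \<Longrightarrow> pm A \<in> carrier G"
  by (simp add: carrier_G)

lemma pm_minus: "pm (- A) = pm A"
  by (auto simp: pm_def)

lemma pm_elem_T_0: "pm (elem_T 0) = \<one>\<^bsub>G\<^esub>"
  by (simp add: elem_T_eq_mat2 mat_1_eq_mat2)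

lemma pm_elem_T_minus: "algebraic_int x \<Longrightarrow> pm (elem_T (- x)) = inv\<^bsub>G\<^esub> pm (elem_T x)"
  using pm_mult[of "elem_T (- x)" "elem_T x"] pm_elem_T_0 elem_T_C elem_T_add[of "- x" x]
  by (intro G.inv_equality[symmetric] pm_in_G) (auto intro: algebraic_int_minus)

lemma pm_elem_T_pow: "algebraic_int x \<Longrightarrow> pm (elem_T (of_nat l * x)) = pm (elem_T x) [^]\<^bsub>G\<^esub> l"
proof (induction l)
  case 0
  show ?case
    using pm_elem_T_0 by simp
next
  case (Suc l)
  have "elem_T (of_nat (Suc l) * x) = elem_T (of_nat l * x) ** elem_T x"
    unfolding elem_T_add[symmetric] by (simp add: algebra_simps)
  with Suc show ?case
    by (simp add: pm_mult elem_T_C algebraic_int_closed)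
qed

text \<open>The factorial of the index satisfies the condition under \<open>LEAST\<close>, so the
  level is attained and positive. Since the core is a subgroup and \<open>elem_T\<close> is
  additive, membership extends from the basis to all integers.\<close>

lemma level_spec:
  assumes basis: "integral_basis n w" and K: "subgroup K G" and fin: "finite (rcosets\<^bsub>G\<^esub> K)"
  shows "level G n w K > 0"
    and "algebraic_int x \<Longrightarrow> pm (elem_T (of_nat (level G n w K) * x)) \<in> normal_core G K"
proof -
  let ?U = "\<lambda>m. (\<lambda>i. pm (elem_T (of_nat m * w i))) ` {1..n}"
  have alg: "algebraic_int (w i)" if "i \<in> {1..n}" for i
    by (rule integral_basis_algebraic_int[OF basis that])
  have U: "?U m \<subseteq> carrier G" for m
    by (intro image_subsetI pm_in_G elem_T_C algebraic_int_mult algebraic_int_of_nat alg)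
  have core: "subgroup (normal_core G K) G"
    by (intro normal_imp_subgroup G.normal_core_normal K)
  have iff: "normal_closure G (generate G (?U m)) \<subseteq> K \<longleftrightarrow> ?U m \<subseteq> normal_core G K" for m
    unfolding G.normal_closure_subset_iff[OF K G.generate_incl[OF U]]
    using G.generate_subgroup_incl[OF _ core, of "?U m"] generate.incl[of _ "?U m" G]
    by (meson subsetI subset_trans)
  let ?c = "fact (card (rcosets\<^bsub>G\<^esub> K)) :: nat"
  have "?U ?c \<subseteq> normal_core G K"
  proof (rule image_subsetI)
    fix i assume "i \<in> {1..n}"
    then have i: "algebraic_int (w i)"
      by (rule alg)
    show "pm (elem_T (of_nat ?c * w i)) \<in> normal_core G K"
      unfolding pm_elem_T_pow[OF i]
      by (rule G.pow_fact_card_rcosets_in_normal_core[OF K fin pm_in_G[OF elem_T_C[OF i]]])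
  qed
  then have ex: "0 < ?c \<and> normal_closure G (generate G (?U ?c)) \<subseteq> K"
    unfolding iff by (intro conjI fact_gt_zero)
  let ?m = "level G n w K"
  have m: "0 < ?m \<and> normal_closure G (generate G (?U ?m)) \<subseteq> K"
    unfolding level_def by (rule LeastI, rule ex)
  then show "?m > 0"
    by (rule conjunct1)
  have base: "pm (elem_T (of_nat ?m * w i)) \<in> normal_core G K" if "i \<in> {1..n}" for i
    using m that unfolding iff by (meson image_subset_iff)
  assume x: "algebraic_int x"
  show "pm (elem_T (of_nat ?m * x)) \<in> normal_core G K"
  proof (rule integral_basis_induct[OF basis x])
    show "pm (elem_T (of_nat ?m * 0)) \<in> normal_core G K"
      using subgroup.one_closed[OF core] unfolding mult_zero_right pm_elem_T_0 .
  next
    fix x y :: 'a assume "algebraic_int x" "algebraic_int y"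
      and "pm (elem_T (of_nat ?m * x)) \<in> normal_core G K" "pm (elem_T (of_nat ?m * y)) \<in> normal_core G K"
    then show "pm (elem_T (of_nat ?m * (x + y))) \<in> normal_core G K"
      unfolding distrib_left elem_T_add
      by (subst pm_mult)
        (simp_all only: elem_T_C algebraic_int_mult algebraic_int_of_nat subgroup.m_closed[OF core])
  next
    fix x :: 'a assume x: "algebraic_int x" "pm (elem_T (of_nat ?m * x)) \<in> normal_core G K"
    have "pm (elem_T (- (of_nat ?m * x))) \<in> normal_core G K"
      unfolding pm_elem_T_minus[OF algebraic_int_mult[OF algebraic_int_of_nat x(1)]]
      by (rule subgroup.m_inv_closed[OF core x(2)])
    then show "pm (elem_T (of_nat ?m * (- x))) \<in> normal_core G K"
      unfolding mult_minus_right .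
  qed (rule base)
qed

text \<open>Of the two representatives, the one congruent to \<open>mat 1\<close> is chosen; a sign
  change handles the other alternative.\<close>

lemma principal_congruence_repr:
  assumes I: "ideal I ring_of_integers" and X: "X \<in> principal_congruence G I"
  obtains A where "A \<in> C" "X = pm A" "mat_cong I A (mat 1)"
proof -
  obtain A where A: "A \<in> C" "X = pm A"
    using X by (auto simp: principal_congruence_def carrier_G)
  obtain B where B: "B = A \<or> B = - A" "mat_cong I B (mat 1) \<or> mat_cong I B (- mat 1)"
    using X A by (auto simp: principal_congruence_def pm_def)
  then have "B \<in> C" "- B \<in> C" "X = pm B" "X = pm (- B)"
    using A minus_C pm_minus by auto
  then show ?thesis
    using B(2) that mat_cong_minus[OF I] by blast
qed

lemma congruence_subgroup_iff:
  assumes basis: "integral_basis n w" and K: "subgroup K G" and fin: "finite (rcosets\<^bsub>G\<^esub> K)"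
  shows "congruence_subgroup G K \<longleftrightarrow>
    principal_congruence G (PIdl\<^bsub>ring_of_integers\<^esub> (of_nat (level G n w K))) \<subseteq> K"
proof
  let ?m = "level G n w K"
  let ?I = "PIdl\<^bsub>ring_of_integers\<^esub> (of_nat ?m :: 'a)"
  have I: "ideal ?I ring_of_integers"
    by (intro ideal_PIdl algebraic_int_closed)
  {
    assume "principal_congruence G ?I \<subseteq> K"
    \<comment> \<open>As the level is positive, \<open>?m\<close> witnesses that \<open>?I\<close>
      is a nonzero ideal.\<close>
    moreover have "of_nat ?m \<in> ?I"
      using algebraic_int_1[where 'a = 'a] by (force simp: PIdl_ring_of_integers)
    moreover have "of_nat ?m \<noteq> (0 :: 'a)"
      using level_spec(1)[OF assms] by simp
    ultimately show "congruence_subgroup G K"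
      unfolding congruence_subgroup_def using I K by blast
  }
  assume "congruence_subgroup G K"
  then obtain J where J: "ideal J ring_of_integers" "J \<noteq> {0}" "principal_congruence G J \<subseteq> K"
    by (auto simp: congruence_subgroup_def)
  obtain k where k: "k > 0" "of_nat k \<in> J"
    by (rule ideal_integers_contains_nat[OF J(1,2)])
  have kJ: "PIdl\<^bsub>ring_of_integers\<^esub> (of_nat k) \<subseteq> J"
    using k(2) by (auto simp: PIdl_ring_of_integers intro: ideal_integers_mult_left[OF J(1)])
  have core: "normal_core G K \<lhd> G"
    by (intro G.normal_core_normal K)
  \<comment> \<open>The preimage in \<open>C\<close> of the core: closed under products and, by
    normality, under conjugation by elements of \<open>C\<close>.\<close>
  define N where "N = {A \<in> C. pm A \<in> normal_core G K}"
  have mult: "A ** B \<in> N" if "A \<in> N" "B \<in> N" for A B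
    using that H.m_closed[of A B] subgroup.m_closed[OF normal_imp_subgroup[OF core]]
    by (simp add: N_def pm_mult del: mult_FactGroup)
  \<comment> \<open>Stating the inverse through \<open>P ** Q = mat 1\<close> lets the concrete
    conjugations by \<open>elem_T x\<close> and \<open>elem_S\<close> be checked by
    computation.\<close>
  have conj: "P ** A ** Q \<in> N" if "A \<in> N" "P \<in> C" "Q \<in> C" "P ** Q = mat 1" for A P Q
  proof -
    have "Q = inv\<^bsub>H\<^esub> P"
      using that by (intro H.inv_equality[symmetric]) (auto intro: H.inv_comm[simplified])
    then have "pm Q = inv\<^bsub>G\<^esub> pm P"
      using that pm_hom H.group_axioms G.group_axioms
      by (simp add: group_hom.hom_inv group_hom_def group_hom_axioms_def)
    moreover have "P ** A \<in> C" "P ** A ** Q \<in> C"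
      using that H.m_closed[of P A] H.m_closed[of "P ** A" Q] by (auto simp: N_def)
    ultimately show ?thesis
      using that normal.inv_op_closed2[OF core pm_in_G]
      by (simp add: N_def pm_mult del: mult_FactGroup)
  qed
  show "principal_congruence G ?I \<subseteq> K"
  proof
    fix X assume "X \<in> principal_congruence G ?I"
    then obtain A where A: "A \<in> C" "X = pm A" "mat_cong ?I A (mat 1)"
      by (rule principal_congruence_repr[OF I])
    have "\<exists>B\<in>N. mat_cong (PIdl\<^bsub>ring_of_integers\<^esub> (of_nat k)) A B"
    proof (rule congruent_to_elementary[OF basis k(1) I])
      show "A ** B \<in> N" if "A \<in> N" "B \<in> N" for A B
        by (rule mult[OF that])
      show "elem_T x ** A ** elem_T (- x) \<in> N" if "A \<in> N" "algebraic_int x" for A x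
        using that by (intro conj elem_T_C algebraic_int_minus)
          (simp_all add: elem_T_eq_mat2 mat_1_eq_mat2)
      show "elem_S ** A ** (- elem_S) \<in> N" if "A \<in> N" for A
        using that by (intro conj elem_S_C minus_C) (simp_all add: elem_S_eq_mat2 mat_1_eq_mat2)
      show "elem_T x \<in> N" if "x \<in> ?I" for x
        using that level_spec(2)[OF assms]
        by (auto simp: PIdl_ring_of_integers N_def mult.commute intro!: elem_T_C algebraic_int_closed)
      show "A \<in> carrier SL2" "mat_cong ?I A (mat 1)"
        using A C_subset by auto
    qed
    then obtain B where B: "B \<in> N" "mat_cong (PIdl\<^bsub>ring_of_integers\<^esub> (of_nat k)) A B"
      by blast
    then have BC: "B \<in> C" "pm B \<in> K"
      using G.normal_core_subset by (auto simp: N_def)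
    \<comment> \<open>\<open>A\<close> is the product of \<open>A ** B'\<close>, which is congruent
      to \<open>mat 1\<close> modulo \<open>J\<close>, and \<open>B\<close>, whose class lies in the
      core; both classes belong to \<open>K\<close>.\<close>
    define B' where "B' = inv\<^bsub>H\<^esub> B"
    have B': "B' \<in> C" "B' ** B = mat 1" "B ** B' = mat 1"
      using BC H.inv_closed[of B] H.l_inv[of B] H.r_inv[of B] by (simp_all add: B'_def)
    have "mat_cong J A B"
      using B(2) kJ by (auto simp: mat_cong_def)
    then have "mat_cong J (mat 1 ** A ** B') (mat 1 ** B ** B')"
      using B' C_subset by (intro mat_cong_mult J(1)) (auto simp: mat_1_in_SL2)
    moreover have AB': "A ** B' \<in> C"
      using A B' H.m_closed[of A B'] by simp
    ultimately have "pm (A ** B') \<in> principal_congruence G J"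
      using B' pm_in_G by (auto simp: principal_congruence_def pm_def)
    then have "pm (A ** B') \<otimes>\<^bsub>G\<^esub> pm B \<in> K"
      using J(3) BC subgroup.m_closed[OF K] by blast
    also have "pm (A ** B') \<otimes>\<^bsub>G\<^esub> pm B = pm (A ** (B' ** B))"
      using AB' BC by (simp add: pm_mult matrix_mul_assoc del: mult_FactGroup)
    also have "\<dots> = X"
      using A B' by simp
    finally show "X \<in> K" .
  qed
qed

end

section \<open>The two groups of the theorem as instances\<close>

lemma elementary_overgroup_SL2: "elementary_overgroup (carrier SL2)"
  by (rule elementary_overgroup.intro) (simp_all add: group.subgroup_self[OF group_SL2] elem_S_in_SL2 elem_T_in_SL2)

text \<open>Additivity of \<open>elem_T\<close> yields every integral \<open>elem_T x\<close> from
  the generators attached to the basis.\<close>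

lemma elementary_overgroup_generate:
  fixes w :: "nat \<Rightarrow> 'a::field_char_0"
  assumes basis: "integral_basis n w"
  shows "elementary_overgroup (generate SL2 (insert elem_S ((\<lambda>i. elem_T (w i)) ` {1..n})))"
    (is "elementary_overgroup (generate SL2 ?S)")
proof (rule elementary_overgroup.intro)
  show sub: "subgroup (generate SL2 ?S) SL2"
    using integral_basis_algebraic_int[OF basis]
    by (intro group.generate_is_subgroup[OF group_SL2]) (auto intro: elem_S_in_SL2 elem_T_in_SL2)
  show "elem_S \<in> generate SL2 ?S"
    by (intro generate.incl) simp
  fix x :: 'a assume x: "algebraic_int x"
  show "elem_T x \<in> generate SL2 ?S"
  proof (rule integral_basis_induct[OF basis x])
    show "elem_T (w i) \<in> generate SL2 ?S" if "i \<in> {1..n}" for i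
      using that by (intro generate.incl) simp
    show "elem_T 0 \<in> generate SL2 ?S"
      using generate.one[of SL2 ?S] by (simp add: elem_T_eq_mat2 mat_1_eq_mat2)
    show "elem_T (x + y) \<in> generate SL2 ?S"
      if "elem_T x \<in> generate SL2 ?S" "elem_T y \<in> generate SL2 ?S" for x y
      using generate.eng[OF that] by (simp add: elem_T_add)
    fix x :: 'a assume x: "algebraic_int x" "elem_T x \<in> generate SL2 ?S"
    have "inv\<^bsub>SL2\<^esub> (elem_T x) = elem_T (- x)"
      using x by (intro group.inv_equality[OF group_SL2] elem_T_in_SL2 algebraic_int_minus)
        (simp_all add: elem_T_eq_mat2 mat_1_eq_mat2)
    then show "elem_T (- x) \<in> generate SL2 ?S"
      using subgroup.m_inv_closed[OF sub x(2)] by simp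
  qed
qed

theorem theorem3p6:
  fixes n m :: nat
    and w :: "nat \<Rightarrow> 'a::field_char_0"
    and G :: "('a ^ 2 ^ 2) set monoid"
    and K :: "('a ^ 2 ^ 2) set set"
  assumes "number_field TYPE('a)"
    and "integral_basis n w" and "w 1 = 1"
    and "G = PSL2 \<or> G = PE n w"
    and "subgroup K G" and "finite (rcosets\<^bsub>G\<^esub> K)"
    and "level G n w K = m"
  shows "congruence_subgroup G K \<longleftrightarrow>
         principal_congruence G (PIdl\<^bsub>ring_of_integers\<^esub> (of_nat m)) \<subseteq> K"
proof -
  \<comment> \<open>\<open>C\<close> is all of SL(2) in the first case and the underlying set of
    \<open>E\<close> in the second.\<close>
  obtain C :: "('a ^ 2 ^ 2) set"
    where "elementary_overgroup C" "G = SL2\<lparr>carrier := C\<rparr> Mod pm (mat 1)"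
    using assms(4)
  proof
    assume "G = PSL2"
    then show ?thesis
      by (intro that[OF elementary_overgroup_SL2]) (simp add: PSL2_def)
  next
    assume "G = PE n w"
    then show ?thesis
      by (intro that[OF elementary_overgroup_generate[OF assms(2)]])
        (simp add: PE_def elementary_group_def)
  qed
  with elementary_overgroup.congruence_subgroup_iff[of C n w K] assms show ?thesis
    by simp
qed

end
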